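(* Let $\mathfrak{S}$ be a faithful cartesian club, $\mathcal{M}$ an $\mathfrak{S}$-multicategory, and $(A,\bullet)$ an applicative system in $\mathcal{M}$. Then: 1. If $\mathfrak{S}$ contains the bijections, then $(A,\bullet)$ is weakly $\mathbf{Bij}$-combinatory complete if and only if it is a $\mathsf{BCI}$-algebra. 2. If $\mathfrak{S}$ contains the monotone injections, then $(A,\bullet)$ is weakly $\mathbf{Minj}$-combinatory complete if and only if it is a $\mathsf{BKI}$-algebra. 3. If $\mathfrak{S}$ contains the injections, then $(A,\bullet)$ is weakly $\mathbf{Inj}$-combinatory complete if and only if it is a $\mathsf{BCKI}$-algebra. 4. If $\mathfrak{S}$ contains the surjections, then $(A,\bullet)$ is weakly $\mathbf{Srj}$-combinatory complete if and only if it is a $\mathsf{BCWI}$-algebra. 5. If $\mathfrak{S}=\mathbf{Fun}$, then $(A,\bullet)$ is weakly $\mathbf{Fun}$-combinatory complete if and only if it is a $\mathsf{BCKWI}$-algebra.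
   Context: Clubs. $\mathbf{Fun}$ is the category with objects the natural numbers and morphisms $n\to m$ the functions $\underline{n}\to\underline{m}$, where $\underline{n}=\{1,\ldots,n\}$. For $\mathbf{a}:n\to m$, $\mathbf{b}:h\to k$, $\mathbf{a}+\mathbf{b}:n+h\to m+k$ is $x\mapsto\mathbf{a}(x)$ for $x\le n$ and $x\mapsto\mathbf{b}(x-n)+m$ for $x>n$. For $\mathbf{a}:m\to n$ and $k_1,\ldots,k_n\in\mathbb{N}$, the wreath product $\mathbf{a}\wr(k_1,\ldots,k_n):\sum_{j=1}^m k_{\mathbf{a}(j)}\to\sum_{i=1}^n k_i$ sends the $p$-th element of the $j$-th block (of size $k_{\mathbf{a}(j)}$) to the $p$-th element of the $\mathbf{a}(j)$-th block. A faithful cartesian club is a subcategory $\mathfrak{S}$ of $\mathbf{Fun}$ containing all objects and closed under $+$ and under $\mathbf{a}\mapsto\mathbf{a}\wr(k_1,\ldots,k_n)$ for all $k_i$. The clubs $\mathbf{Bij},\mathbf{Minj},\mathbf{Inj},\mathbf{Srj}$ consist respectively of all bijections, monotone injections, injections, surjections in $\mathbf{Fun}$. Multicategories. A multicategory $\mathcal{M}$ has objects $\mathcal{M}_0$, morphism sets $\mathcal{M}(A_1,\ldots,A_n;B)$ ($n\ge 0$), identities $1_A\in\mathcal{M}(A;A)$, and associative unital composition sending $f\in\mathcal{M}(A_1,\ldots,A_n;B)$, $g_i\in\mathcal{M}(\Gamma_i;A_i)$ to $f\circ(g_1,\ldots,g_n)\in\mathcal{M}(\Gamma_1,\ldots,\Gamma_n;B)$.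 $A^n$ (resp. $f^n$) means $n$ copies of $A$ (resp. $f$). An $\mathfrak{S}$-multicategory is a multicategory with operations $[-]\mathbf{a}:\mathcal{M}(A_{\mathbf{a}(1)},\ldots,A_{\mathbf{a}(m)};B)\to\mathcal{M}(A_1,\ldots,A_n;B)$ for each $\mathbf{a}:m\to n$ in $\mathfrak{S}$, such that $[[f]\mathbf{a}]\mathbf{b}=[f](\mathbf{b}\circ\mathbf{a})$; $[f]1=f$; $g\circ([f_1]\mathbf{a}_1,\ldots,[f_n]\mathbf{a}_n)=[g\circ(f_1,\ldots,f_n)](\mathbf{a}_1+\cdots+\mathbf{a}_n)$; and $[g]\mathbf{a}\circ(f_1,\ldots,f_n)=[g\circ(f_{\mathbf{a}(1)},\ldots,f_{\mathbf{a}(m)})](\mathbf{a}\wr(k_1,\ldots,k_n))$ where $k_i$ is the arity of $f_i$. If $\mathfrak{S}'\subseteq\mathfrak{S}$ are clubs, an $\mathfrak{S}$-multicategory is regarded as an $\mathfrak{S}'$-multicategory by restricting the action. A sub-$\mathfrak{S}$-multicategory is given by subcollections of objects and of morphisms containing identities and closed under composition and under the action of $\mathfrak{S}$. Applicative systems. An applicative system $(A,\bullet)$ in $\mathcal{M}$ is an object $A$ with $\bullet\in\mathcal{M}(A,A;A)$. Put $\bullet^0=1_A$, $\bullet^{n+1}=\bullet\circ(\bullet^n,1_A)\in\mathcal{M}(A,A^{n+1};A)$. $f\in\mathcal{M}(A^n;A)$ is $(A,\bullet)$-computable if $f=\bullet^n\circ(a,1_A^n)$ for some $a\in\mathcal{M}(;A)$.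 For a club $\mathfrak{S}$ acting on $\mathcal{M}$, $(A,\bullet)$ is weakly $\mathfrak{S}$-combinatory complete if every morphism of the smallest sub-$\mathfrak{S}$-multicategory of $\mathcal{M}$ containing $\bullet$ is $(A,\bullet)$-computable. Combinators (all elements of $\mathcal{M}(;A)$). $\mathsf{B}$: $\bullet^3\circ(\mathsf{B},1_A,1_A,1_A)=\bullet\circ(1_A,\bullet)$. $\mathsf{I}$: $\bullet\circ(\mathsf{I},1_A)=1_A$. $\mathsf{C}$ (when $\mathfrak{S}$ contains the transpositions): $\bullet^3\circ(\mathsf{C},1_A,1_A,1_A)=[\bullet^2]\tau_2^3$, where $\tau_2^3:3\to 3$ swaps $2$ and $3$ (i.e. $\mathsf{C}x_1x_2x_3=x_1x_3x_2$). $\mathsf{W}$ (when $\mathfrak{S}$ contains the degeneracy maps, i.e. the maps $\sigma_i^n:n+1\to n$, $x\mapsto x$ for $x\le i$, $x\mapsto x-1$ for $x>i$): $\bullet^2\circ(\mathsf{W},1_A,1_A)=[\bullet^2]\sigma_2^2$ (i.e. $\mathsf{W}x_1x_2=x_1x_2x_2$). $\mathsf{K}$ (when $\mathfrak{S}$ contains the face maps, i.e. the maps $\delta_i^n:n-1\to n$, $x\mapsto x$ for $x<i$, $x\mapsto x+1$ for $x\ge i$): $\bullet^2\circ(\mathsf{K},1_A,1_A)=[1_A]\delta_2^2$ (i.e. $\mathsf{K}x_1x_2=x_1$). For a set $H$ of these letters, $(A,\bullet)$ is an $H$-algebra if it has every combinator in $H$. *)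

theory Defs
  imports Main
begin

section \<open>Clubs\<close>

text \<open>
  The finite set with n elements is taken to be {0,...,n-1}, so that it matches list
  indexing; all positions are shifted by one from the usual {1,...,n}. A function
  a : n --> m is given by its list of values, of length n, with all entries below m.
  The codomain m is not recorded in the list, so a class of functions is a family of
  sets of lists indexed by domain and codomain.
\<close>

type_synonym map_class = "nat \<Rightarrow> nat \<Rightarrow> nat list set"

definition Fun_club :: map_class where
  "Fun_club n m = {a. length a = n \<and> set a \<subseteq> {..<m}}"

definition Bij_club :: map_class where
  "Bij_club n m = {a \<in> Fun_club n m. bij_betw (\<lambda>j. a ! j) {..<n} {..<m}}"

definition Inj_club :: map_class where
  "Inj_club n m = {a \<in> Fun_club n m. inj_on (\<lambda>j. a ! j) {..<n}}"

definition Minj_club :: map_class where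
  "Minj_club n m = {a \<in> Fun_club n m. inj_on (\<lambda>j. a ! j) {..<n} \<and> mono_on {..<n} (\<lambda>j. a ! j)}"

definition Srj_club :: map_class where
  "Srj_club n m = {a \<in> Fun_club n m. (\<lambda>j. a ! j) ` {..<n} = {..<m}}"

text \<open>
  reindex xs a is the family with j-th member x at index a(j). Applied to lists of values
  b and a of composable functions it yields the composite of b after a.
\<close>

definition reindex :: "'a list \<Rightarrow> nat list \<Rightarrow> 'a list" where
  "reindex xs a = map (\<lambda>j. xs ! j) a"

abbreviation fun_comp :: "nat list \<Rightarrow> nat list \<Rightarrow> nat list" where
  "fun_comp b a \<equiv> reindex b a"

definition fun_id :: "nat \<Rightarrow> nat list" where
  "fun_id n = [0..<n]"

text \<open>The first argument of the sum is the codomain of the first summand.\<close>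

definition fun_plus :: "nat \<Rightarrow> nat list \<Rightarrow> nat list \<Rightarrow> nat list" where
  "fun_plus m a b = a @ map (\<lambda>x. x + m) b"

text \<open>Iterated sum of functions, each paired with its codomain.\<close>

fun fun_sum :: "(nat \<times> nat list) list \<Rightarrow> nat list" where
  "fun_sum [] = []"
| "fun_sum ((m, a) # as) = fun_plus m a (fun_sum as)"

text \<open>
  The block of index i in the codomain starts at the sum of the sizes of the blocks before it.
\<close>

definition wreath :: "nat list \<Rightarrow> nat list \<Rightarrow> nat list" where
  "wreath a ks = concat (map (\<lambda>i. map (\<lambda>p. sum_list (take i ks) + p) [0..<ks ! i]) a)"

locale faithful_cartesian_club =
  fixes S :: map_class
  assumes maps: "a \<in> S n m \<Longrightarrow> a \<in> Fun_club n m"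
    and id_closed: "fun_id n \<in> S n n"
    and comp_closed: "a \<in> S n m \<Longrightarrow> b \<in> S m k \<Longrightarrow> fun_comp b a \<in> S n k"
    and plus_closed: "a \<in> S n m \<Longrightarrow> b \<in> S h k \<Longrightarrow> fun_plus m a b \<in> S (n + h) (m + k)"
    and wreath_closed: "a \<in> S m n \<Longrightarrow> length ks = n \<Longrightarrow>
      wreath a ks \<in> S (\<Sum>j<m. ks ! (a ! j)) (\<Sum>i<n. ks ! i)"

text \<open>
  The superscript n and the subscript i of the standard maps keep their usual values
  (counting from 1), while the functions themselves act on {0,...,n-1}: tau n i
  interchanges the i-th and the (i+1)-st element.
\<close>

definition tau :: "nat \<Rightarrow> nat \<Rightarrow> nat list" where
  "tau n i = map (\<lambda>x. if x + 1 = i then x + 1 else if x = i then x - 1 else x) [0..<n]"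

definition sigma :: "nat \<Rightarrow> nat \<Rightarrow> nat list" where
  "sigma n i = map (\<lambda>x. if x + 1 \<le> i then x else x - 1) [0..<n + 1]"

definition delta :: "nat \<Rightarrow> nat \<Rightarrow> nat list" where
  "delta n i = map (\<lambda>x. if x + 1 < i then x else x + 1) [0..<n - 1]"

lemma tau_3_2: "tau 3 2 = [0, 2, 1]"
  and sigma_2_2: "sigma 2 2 = [0, 1, 1]"
  and delta_2_2: "delta 2 2 = [0]"
  by (simp_all add: tau_def sigma_def delta_def upt_rec)


section \<open>Multicategories\<close>

record ('o, 'm) multicat =
  obj :: "'o set"
  mor :: "'m set"
  src :: "'m \<Rightarrow> 'o list"
  tgt :: "'m \<Rightarrow> 'o"
  ident :: "'o \<Rightarrow> 'm"
  mcomp :: "'m \<Rightarrow> 'm list \<Rightarrow> 'm"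

definition hom :: "('o, 'm, 'z) multicat_scheme \<Rightarrow> 'o list \<Rightarrow> 'o \<Rightarrow> 'm set" where
  "hom M \<Gamma> B = {f \<in> mor M. src M f = \<Gamma> \<and> tgt M f = B}"

locale multicategory =
  fixes M :: "('o, 'm, 'z) multicat_scheme" (structure)
  assumes src_obj: "f \<in> mor M \<Longrightarrow> set (src M f) \<subseteq> obj M"
    and tgt_obj: "f \<in> mor M \<Longrightarrow> tgt M f \<in> obj M"
    and ident_hom: "A \<in> obj M \<Longrightarrow> ident M A \<in> hom M [A] A"
    and mcomp_hom: "f \<in> mor M \<Longrightarrow> set gs \<subseteq> mor M \<Longrightarrow> map (tgt M) gs = src M f \<Longrightarrow>
      mcomp M f gs \<in> hom M (concat (map (src M) gs)) (tgt M f)"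
    and mcomp_ident_right: "f \<in> mor M \<Longrightarrow> mcomp M f (map (ident M) (src M f)) = f"
    and mcomp_ident_left: "f \<in> mor M \<Longrightarrow> mcomp M (ident M (tgt M f)) [f] = f"
    and mcomp_assoc: "f \<in> mor M \<Longrightarrow> set gs \<subseteq> mor M \<Longrightarrow> map (tgt M) gs = src M f \<Longrightarrow>
      length hss = length gs \<Longrightarrow>
      (\<And>i. i < length gs \<Longrightarrow>
        set (hss ! i) \<subseteq> mor M \<and> map (tgt M) (hss ! i) = src M (gs ! i)) \<Longrightarrow>
      mcomp M (mcomp M f gs) (concat hss) = mcomp M f (map2 (mcomp M) gs hss)"

text \<open>
  act M Ds a f is the result of letting a act on f, in the hom-set with source Ds. The list
  Ds has to be given: if a is not surjective, it is not determined by a and f.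
\<close>

record ('o, 'm) act_multicat = "('o, 'm) multicat" +
  act :: "'o list \<Rightarrow> nat list \<Rightarrow> 'm \<Rightarrow> 'm"

locale club_multicategory =
  faithful_cartesian_club S + multicategory M
  for S :: map_class and M :: "('o, 'm, 'z) act_multicat_scheme" (structure) +
  assumes act_hom: "a \<in> S m (length Ds) \<Longrightarrow> set Ds \<subseteq> obj M \<Longrightarrow> f \<in> hom M (reindex Ds a) B \<Longrightarrow>
      act M Ds a f \<in> hom M Ds B"
    and act_act: "a \<in> S m n \<Longrightarrow> b \<in> S n (length Ds) \<Longrightarrow> set Ds \<subseteq> obj M \<Longrightarrow>
      f \<in> hom M (reindex Ds (fun_comp b a)) B \<Longrightarrow>
      act M Ds b (act M (reindex Ds b) a f) = act M Ds (fun_comp b a) f"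
    and act_id: "f \<in> mor M \<Longrightarrow> act M (src M f) (fun_id (length (src M f))) f = f"
    and mcomp_act: "g \<in> mor M \<Longrightarrow> n = length (src M g) \<Longrightarrow>
      (\<And>i. i < n \<Longrightarrow> \<alpha> i \<in> S (ms i) (length (\<Delta> i)) \<and> set (\<Delta> i) \<subseteq> obj M \<and>
        \<phi> i \<in> hom M (reindex (\<Delta> i) (\<alpha> i)) (src M g ! i)) \<Longrightarrow>
      mcomp M g (map (\<lambda>i. act M (\<Delta> i) (\<alpha> i) (\<phi> i)) [0..<n]) =
        act M (concat (map \<Delta> [0..<n])) (fun_sum (map (\<lambda>i. (length (\<Delta> i), \<alpha> i)) [0..<n]))
          (mcomp M g (map \<phi> [0..<n]))"
    and act_mcomp: "a \<in> S m (length Ds) \<Longrightarrow> g \<in> hom M (reindex Ds a) B \<Longrightarrow>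
      set fs \<subseteq> mor M \<Longrightarrow> map (tgt M) fs = Ds \<Longrightarrow>
      mcomp M (act M Ds a g) fs =
        act M (concat (map (src M) fs)) (wreath a (map (\<lambda>f. length (src M f)) fs))
          (mcomp M g (reindex fs a))"

text \<open>
  The class S' is only used to select which of the operations of M are considered, so for a
  club S' contained in S this also covers the structure obtained by restricting the action.
\<close>

definition sub_club_multicategory ::
  "map_class \<Rightarrow> ('o, 'm, 'z) act_multicat_scheme \<Rightarrow> 'o set \<Rightarrow> 'm set \<Rightarrow> bool" where
  "sub_club_multicategory S' M Os Fs \<longleftrightarrow>
     Os \<subseteq> obj M \<and> Fs \<subseteq> mor M \<and>
     (\<forall>f\<in>Fs. set (src M f) \<subseteq> Os \<and> tgt M f \<in> Os) \<and>
     (\<forall>A\<in>Os. ident M A \<in> Fs) \<and>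
     (\<forall>f\<in>Fs. \<forall>gs. set gs \<subseteq> Fs \<and> map (tgt M) gs = src M f \<longrightarrow> mcomp M f gs \<in> Fs) \<and>
     (\<forall>f\<in>Fs. \<forall>m a Ds. a \<in> S' m (length Ds) \<and> set Ds \<subseteq> Os \<and> src M f = reindex Ds a
        \<longrightarrow> act M Ds a f \<in> Fs)"

definition generated_morphisms ::
  "map_class \<Rightarrow> ('o, 'm, 'z) act_multicat_scheme \<Rightarrow> 'm \<Rightarrow> 'm set" where
  "generated_morphisms S' M h = \<Inter>{Fs. \<exists>Os. sub_club_multicategory S' M Os Fs \<and> h \<in> Fs}"


section \<open>Applicative systems\<close>

definition applicative_system :: "('o, 'm, 'z) multicat_scheme \<Rightarrow> 'o \<Rightarrow> 'm \<Rightarrow> bool" where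
  "applicative_system M A ap \<longleftrightarrow> A \<in> obj M \<and> ap \<in> hom M [A, A] A"

fun ap_power :: "('o, 'm, 'z) multicat_scheme \<Rightarrow> 'o \<Rightarrow> 'm \<Rightarrow> nat \<Rightarrow> 'm" where
  "ap_power M A ap 0 = ident M A"
| "ap_power M A ap (Suc n) = mcomp M ap [ap_power M A ap n, ident M A]"

definition computable :: "('o, 'm, 'z) multicat_scheme \<Rightarrow> 'o \<Rightarrow> 'm \<Rightarrow> 'm \<Rightarrow> bool" where
  "computable M A ap f \<longleftrightarrow>
     (\<exists>n. f \<in> hom M (replicate n A) A \<and>
       (\<exists>a \<in> hom M [] A. f = mcomp M (ap_power M A ap n) (a # replicate n (ident M A))))"

definition weakly_combinatory_complete ::
  "map_class \<Rightarrow> ('o, 'm, 'z) act_multicat_scheme \<Rightarrow> 'o \<Rightarrow> 'm \<Rightarrow> bool" where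
  "weakly_combinatory_complete S' M A ap \<longleftrightarrow>
     (\<forall>f \<in> generated_morphisms S' M ap. computable M A ap f)"

datatype combinator = CombB | CombC | CombK | CombW | CombI

fun combinator_law ::
  "('o, 'm, 'z) act_multicat_scheme \<Rightarrow> 'o \<Rightarrow> 'm \<Rightarrow> combinator \<Rightarrow> 'm \<Rightarrow> bool" where
  "combinator_law M A ap CombB x \<longleftrightarrow>
     mcomp M (ap_power M A ap 3) [x, ident M A, ident M A, ident M A] = mcomp M ap [ident M A, ap]"
| "combinator_law M A ap CombC x \<longleftrightarrow>
     mcomp M (ap_power M A ap 3) [x, ident M A, ident M A, ident M A] =
       act M [A, A, A] (tau 3 2) (ap_power M A ap 2)"
| "combinator_law M A ap CombK x \<longleftrightarrow>
     mcomp M (ap_power M A ap 2) [x, ident M A, ident M A] = act M [A, A] (delta 2 2) (ident M A)"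
| "combinator_law M A ap CombW x \<longleftrightarrow>
     mcomp M (ap_power M A ap 2) [x, ident M A, ident M A] =
       act M [A, A] (sigma 2 2) (ap_power M A ap 2)"
| "combinator_law M A ap CombI x \<longleftrightarrow> mcomp M ap [x, ident M A] = ident M A"

definition combinator_algebra ::
  "('o, 'm, 'z) act_multicat_scheme \<Rightarrow> 'o \<Rightarrow> 'm \<Rightarrow> combinator set \<Rightarrow> bool" where
  "combinator_algebra M A ap H \<longleftrightarrow> (\<forall>c\<in>H. \<exists>x \<in> hom M [] A. combinator_law M A ap c x)"

end

theory Submission
  imports Defs
begin

text \<open>
  A closed \<open>E\<close> realizes a map \<open>a : p \<rightarrow> q\<close> if \<open>E g y\<^sub>1 \<dots> y\<^sub>q = g y\<^bsub>a(1)\<^esub> \<dots> y\<^bsub>a(p)\<^esub>\<close> for every \<open>g\<close>.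
  With \<open>B\<close> and \<open>I\<close>, the realizable maps contain the identities and are closed under composition
  and \<open>+\<close>; \<open>C\<close>, \<open>K\<close>, \<open>W\<close> say precisely that \<open>2 \<rightarrow> 2\<close> (the swap), \<open>0 \<rightarrow> 1\<close>, \<open>2 \<rightarrow> 1\<close> are realizable,
  and the clubs are generated by these. Computability of the morphisms generated by application
  is proved in the stronger form \<open>c x y\<^sub>1 \<dots> y\<^sub>n = x (f(y\<^sub>1, \<dots>, y\<^sub>n))\<close> for a closed \<open>c\<close> and all \<open>x\<close>,
  which is preserved by composition with the help of \<open>B\<close> alone and by the action of realizable maps;
  taking \<open>x = I\<close> gives computability.
\<close>

section \<open>Generators of the clubs\<close>

lemma length_reindex [simp]: "length (reindex xs a) = length a"
  by (simp add: reindex_def)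

lemma map_eq_replicate: "(\<And>x. x \<in> set xs \<Longrightarrow> f x = c) \<Longrightarrow> map f xs = replicate (length xs) c"
  by (induction xs) auto

lemma replicate_2_3: "replicate 2 x = [x, x]" "replicate 3 x = [x, x, x]"
  by (simp_all add: numeral_2_eq_2 numeral_3_eq_3)

lemma reindex_replicate: "a \<in> Fun_club n m \<Longrightarrow> reindex (replicate m x) a = replicate n x"
  by (auto simp: reindex_def Fun_club_def subset_iff intro!: nth_equalityI)

lemma fun_comp_fun_plus_id:
  assumes "a \<in> Fun_club n m" "length b = m"
  shows "fun_comp (fun_plus k (fun_id k) b) (fun_plus k (fun_id k) a) =
         fun_plus k (fun_id k) (fun_comp b a)"
  using assms
  by (auto simp: reindex_def fun_plus_def fun_id_def Fun_club_def nth_append intro!: nth_equalityI)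

text \<open>This reduces closure under \<open>fun_plus\<close> to sums with an identity on one side,
  which for realizable maps are obtained in two different ways.\<close>

lemma fun_plus_eq_comp:
  assumes "a \<in> Fun_club n m" "b \<in> Fun_club h k"
  shows "fun_plus m a b = fun_comp (fun_plus m a (fun_id k)) (fun_plus n (fun_id n) b)"
  using assms
  by (auto simp: reindex_def fun_plus_def fun_id_def Fun_club_def nth_append subset_iff
      intro!: nth_equalityI)

lemma fun_plus_id_id: "fun_plus m (fun_id m) (fun_id k) = fun_id (m + k)"
  by (auto simp: fun_plus_def fun_id_def nth_append intro!: nth_equalityI)

lemma fun_plus_assoc: "fun_plus m (fun_id m) (fun_plus k a b) = fun_plus (m + k) (fun_plus m (fun_id m) a) b"
  by (simp add: fun_plus_def)

lemma fun_plus_id_fun_plus: "fun_plus (k + j) (fun_id (k + j)) a = fun_plus k (fun_id k) (fun_plus j (fun_id j) a)"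
  by (metis fun_plus_assoc fun_plus_id_id)

lemma fun_plus_1_id: "fun_plus 1 (fun_id 1) a = 0 # map Suc a"
  by (simp add: fun_plus_def fun_id_def)

lemma nth_image_set: "length a = n \<Longrightarrow> (\<lambda>j. a ! j) ` {..<n} = set a"
  by (auto simp: in_set_conv_nth)

lemma inj_nth_distinct: "length a = n \<Longrightarrow> inj_on (\<lambda>j. a ! j) {..<n} \<longleftrightarrow> distinct a"
  by (auto simp: inj_on_def distinct_conv_nth)

lemma Inj_club_iff: "a \<in> Inj_club n m \<longleftrightarrow> length a = n \<and> set a \<subseteq> {..<m} \<and> distinct a"
  using inj_nth_distinct[of a n] unfolding Inj_club_def Fun_club_def by blast

lemma Srj_club_iff: "a \<in> Srj_club n m \<longleftrightarrow> length a = n \<and> set a = {..<m}"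
  using nth_image_set[of a n] unfolding Srj_club_def Fun_club_def by blast

lemma Bij_club_iff: "a \<in> Bij_club n m \<longleftrightarrow> length a = n \<and> set a = {..<m} \<and> distinct a"
  using nth_image_set[of a n] inj_nth_distinct[of a n]
  unfolding Bij_club_def Fun_club_def bij_betw_def by blast

lemma Minj_club_iff:
  "a \<in> Minj_club n m \<longleftrightarrow> length a = n \<and> set a \<subseteq> {..<m} \<and> sorted a \<and> distinct a"
proof -
  have "mono_on {..<n} (\<lambda>j. a ! j) \<longleftrightarrow> sorted a" if "length a = n"
    using that by (auto simp: mono_on_def sorted_iff_nth_mono)
  then show ?thesis
    using inj_nth_distinct[of a n] unfolding Minj_club_def Fun_club_def by blast
qed

text \<open>The function closes the gap left by \<open>v\<close>: away from \<open>v\<close> it is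
  injective, and all values above \<open>v\<close> drop by one. It renormalizes the tail of a list
  of values whose head \<open>v\<close> does not recur, so that inductions can pass to a codomain
  with one point less.\<close>

lemma image_delete_value:
  assumes "v < Suc m" "v \<notin> X"
  shows "X \<subseteq> {..<Suc m} \<Longrightarrow> (\<lambda>x. if x < v then x else x - 1) ` X \<subseteq> {..<m}"
    and "insert v X = {..<Suc m} \<Longrightarrow> (\<lambda>x. if x < v then x else x - 1) ` X = {..<m}"
    and "inj_on (\<lambda>x. if x < v then x else x - 1) X"
proof -
  show *: "(\<lambda>x. if x < v then x else x - 1) ` X \<subseteq> {..<m}" if "X \<subseteq> {..<Suc m}"
  proof (rule image_subsetI)
    fix x assume "x \<in> X"
    with that assms(2) have "x < Suc m" "x \<noteq> v" by blast+
    then show "(if x < v then x else x - 1) \<in> {..<m}" using assms(1) by auto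
  qed
  show "(\<lambda>x. if x < v then x else x - 1) ` X = {..<m}" if X: "insert v X = {..<Suc m}"
  proof
    show "(\<lambda>x. if x < v then x else x - 1) ` X \<subseteq> {..<m}" using * X by blast
    show "{..<m} \<subseteq> (\<lambda>x. if x < v then x else x - 1) ` X"
    proof
      fix y assume "y \<in> {..<m}"
      then have "(if y < v then y else Suc y) \<in> insert v X" unfolding X by auto
      then have "(if y < v then y else Suc y) \<in> X" by (auto split: if_splits)
      then show "y \<in> (\<lambda>x. if x < v then x else x - 1) ` X"
        by (rule rev_image_eqI) auto
    qed
  qed
  show "inj_on (\<lambda>x. if x < v then x else x - 1) X"
  proof (rule inj_onI)
    fix x y assume "x \<in> X" "y \<in> X"
      and eq: "(if x < v then x else x - 1) = (if y < v then y else y - 1)"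
    then have "x \<noteq> v" "y \<noteq> v" using assms(2) by auto
    then show "x = y" using eq by (auto split: if_splits)
  qed
qed

text \<open>These are the club axioms without closure under \<open>wreath\<close>. They suffice to
  generate the five clubs, and they are what can be verified for realizable maps.\<close>

locale pro =
  fixes G :: map_class
  assumes maps: "a \<in> G n m \<Longrightarrow> a \<in> Fun_club n m"
    and id_closed: "fun_id n \<in> G n n"
    and comp_closed: "a \<in> G n m \<Longrightarrow> b \<in> G m k \<Longrightarrow> fun_comp b a \<in> G n k"
    and plus_closed: "a \<in> G n m \<Longrightarrow> b \<in> G h k \<Longrightarrow> fun_plus m a b \<in> G (n + h) (m + k)"
begin

section \<open>Generating the clubs from the swap, the map 2 \<rightarrow> 1 and the map 0
  \<rightarrow> 1\<close>

lemma empty_map_closed: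
  assumes "[] \<in> G 0 1"
  shows "[] \<in> G 0 m"
proof (induction m)
  case 0
  show ?case using id_closed[of 0] by (simp add: fun_id_def)
next
  case (Suc m)
  show ?case using plus_closed[OF assms Suc.IH] by (simp add: fun_plus_def)
qed

text \<open>As a map, the list is the cycle that sends 0 to \<open>v\<close> and
  \<open>j + 1\<close> to \<open>j\<close> for \<open>j < v\<close>. Going from \<open>v\<close> to
  \<open>v + 1\<close> takes one further adjacent swap, of the points \<open>v\<close> and
  \<open>v + 1\<close>, composed after the previous cycle.\<close>

lemma cycle_closed:
  assumes "[1, 0] \<in> G 2 2"
  shows "v # [0..<v] \<in> G (Suc v) (Suc v)"
proof (induction v)
  case 0
  show ?case using id_closed[of 1] by (simp add: fun_id_def)
next
  case (Suc v)
  have "fun_plus (Suc v) (v # [0..<v]) (fun_id 1) \<in> G (Suc v + 1) (Suc v + 1)"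
    using plus_closed[OF Suc.IH id_closed] .
  moreover have "fun_plus v (fun_id v) [1, 0] \<in> G (v + 2) (v + 2)"
    using plus_closed[OF id_closed assms] .
  ultimately have "fun_comp (fun_plus v (fun_id v) [1, 0]) (fun_plus (Suc v) (v # [0..<v]) (fun_id 1))
      \<in> G (Suc (Suc v)) (Suc (Suc v))"
    using comp_closed by simp
  moreover have "fun_comp (fun_plus v (fun_id v) [1, 0]) (fun_plus (Suc v) (v # [0..<v]) (fun_id 1))
      = Suc v # [0..<Suc v]"
    by (auto simp: reindex_def fun_plus_def fun_id_def nth_append intro: map_idI)
  ultimately show ?case by simp
qed

text \<open>Close up the tail at \<open>v\<close>, put a new point 0 in front by adding the identity
  of 1, and then move that point to place \<open>v\<close> by the cycle; the cycle reopens exactly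
  the gap that was closed.\<close>

lemma insert_fresh_closed:
  assumes "[1, 0] \<in> G 2 2" "v < Suc m" "v \<notin> set a" "set a \<subseteq> {..<Suc m}"
    and "map (\<lambda>x. if x < v then x else x - 1) a \<in> G n m"
  shows "v # a \<in> G (Suc n) (Suc m)"
proof -
  let ?a = "map (\<lambda>x. if x < v then x else x - 1) a"
  let ?c = "fun_plus (Suc v) (v # [0..<v]) (fun_id (m - v))"
  have "fun_plus 1 (fun_id 1) ?a \<in> G (1 + n) (1 + m)"
    using plus_closed[OF id_closed assms(5)] .
  moreover have "?c \<in> G (Suc v + (m - v)) (Suc v + (m - v))"
    using plus_closed[OF cycle_closed[OF assms(1)] id_closed] .
  ultimately have "fun_comp ?c (fun_plus 1 (fun_id 1) ?a) \<in> G (Suc n) (Suc m)"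
    using comp_closed assms(2) by simp
  moreover have "fun_comp ?c (fun_plus 1 (fun_id 1) ?a) = v # a"
  proof -
    have "?c ! Suc (if x < v then x else x - 1) = x" if "x \<in> set a" for x
    proof -
      have "x \<noteq> v" "x < Suc m" using that assms by auto
      then show ?thesis
        by (cases "x < v") (auto simp: fun_plus_def fun_id_def nth_append)
    qed
    then show ?thesis
      unfolding fun_plus_1_id by (auto simp: reindex_def fun_plus_def intro!: map_idI)
  qed
  ultimately show ?thesis by simp
qed

text \<open>Here the codomain keeps its size. A new point is put in front, the cycle
  \<open>?c\<close> moves it next to the old point \<open>v\<close>, which now sits at
  \<open>v + 1\<close>, and \<open>?s\<close> merges the two.\<close>

lemma insert_repeated_closed:
  assumes "[1, 0] \<in> G 2 2" "[0, 0] \<in> G 2 1" "v < m" "a \<in> G n m"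
  shows "v # a \<in> G (Suc n) m"
proof -
  let ?c = "fun_plus (Suc v) (v # [0..<v]) (fun_id (m - v))"
  let ?s = "fun_plus v (fun_id v) (fun_plus 1 [0, 0] (fun_id (m - v - 1)))"
  have "fun_plus 1 (fun_id 1) a \<in> G (1 + n) (1 + m)"
    using plus_closed[OF id_closed assms(4)] .
  moreover have "?c \<in> G (Suc v + (m - v)) (Suc v + (m - v))"
    using plus_closed[OF cycle_closed[OF assms(1)] id_closed] .
  moreover have "?s \<in> G (v + (2 + (m - v - 1))) (v + (1 + (m - v - 1)))"
    using plus_closed[OF id_closed plus_closed[OF assms(2) id_closed]] .
  ultimately have "fun_comp ?s (fun_comp ?c (fun_plus 1 (fun_id 1) a)) \<in> G (Suc n) m"
    using assms(3) by (auto intro: comp_closed)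
  moreover have "fun_comp ?s (fun_comp ?c (fun_plus 1 (fun_id 1) a)) = v # a"
  proof -
    have "?s ! (?c ! Suc x) = x" if "x \<in> set a" for x
    proof -
      have "x < m" using that maps[OF assms(4)] by (auto simp: Fun_club_def)
      then show ?thesis
        by (cases x v rule: linorder_cases)
           (auto simp: fun_plus_def fun_id_def nth_append nth_Cons split: nat.split)
    qed
    moreover have "?s ! (?c ! 0) = v"
      by (simp add: fun_plus_def fun_id_def nth_append)
    ultimately show ?thesis
      unfolding fun_plus_1_id by (auto simp: reindex_def intro!: map_idI)
  qed
  ultimately show ?thesis by simp
qed

lemma Bij_club_le:
  assumes "[1, 0] \<in> G 2 2"
  shows "Bij_club \<le> G"
proof -
  have "a \<in> G n m" if "a \<in> Bij_club n m" for a n m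
    using that
  proof (induction n arbitrary: a m)
    case 0
    then have a: "length a = 0" "set a = {..<m}" unfolding Bij_club_iff by blast+
    then have "m = 0" by (cases m) auto
    then show ?case using id_closed[of 0] a(1) by (simp add: fun_id_def)
  next
    case (Suc n)
    obtain v a' where a: "a = v # a'"
      using Suc.prems by (cases a) (simp_all add: Bij_club_iff)
    with Suc.prems have *: "length a' = n" "v \<notin> set a'" "distinct a'" "insert v (set a') = {..<m}"
      by (simp_all add: Bij_club_iff)
    from *(4) have "v < m" by blast
    then obtain m' where m: "m = Suc m'" by (cases m) simp_all
    with \<open>v < m\<close> have v: "v < Suc m'" by simp
    \<comment> \<open>The head \<open>v\<close> does not recur in a bijection, so the closed-up tail
      is again a bijection, onto a codomain with one point less.\<close>
    have "map (\<lambda>x. if x < v then x else x - 1) a' \<in> Bij_club n m'"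
      unfolding Bij_club_iff distinct_map set_map
      using * image_delete_value(2,3)[OF v *(2)] m by simp
    then show ?case
      unfolding a m using *(4) m by (intro insert_fresh_closed[OF assms v *(2) _ Suc.IH]) blast+
  qed
  then show ?thesis by (auto simp: le_fun_def)
qed

lemma Inj_club_le:
  assumes "[1, 0] \<in> G 2 2" "[] \<in> G 0 1"
  shows "Inj_club \<le> G"
proof -
  have "a \<in> G n m" if "a \<in> Inj_club n m" for a n m
    using that
  proof (induction n arbitrary: a m)
    case 0
    then show ?case using empty_map_closed[OF assms(2)] by (auto simp: Inj_club_iff)
  next
    case (Suc n)
    obtain v a' where a: "a = v # a'"
      using Suc.prems by (cases a) (simp_all add: Inj_club_iff)
    with Suc.prems have *: "length a' = n" "v \<notin> set a'" "distinct a'" "set a' \<subseteq> {..<m}" "v < m"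
      by (simp_all add: Inj_club_iff)
    then obtain m' where m: "m = Suc m'" by (cases m) simp_all
    with *(5) have v: "v < Suc m'" by simp
    have "map (\<lambda>x. if x < v then x else x - 1) a' \<in> Inj_club n m'"
      unfolding Inj_club_iff distinct_map set_map
      using * image_delete_value(1,3)[OF v *(2)] m by simp
    then show ?case
      unfolding a m using *(4) m by (intro insert_fresh_closed[OF assms(1) v *(2) _ Suc.IH]) simp_all
  qed
  then show ?thesis by (auto simp: le_fun_def)
qed

lemma Srj_club_le:
  assumes "[1, 0] \<in> G 2 2" "[0, 0] \<in> G 2 1"
  shows "Srj_club \<le> G"
proof -
  have "a \<in> G n m" if "a \<in> Srj_club n m" for a n m
    using that
  proof (induction n arbitrary: a m)
    case 0
    then have a: "length a = 0" "set a = {..<m}" unfolding Srj_club_iff by blast+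
    then have "m = 0" by (cases m) auto
    then show ?case using id_closed[of 0] a(1) by (simp add: fun_id_def)
  next
    case (Suc n)
    obtain v a' where a: "a = v # a'"
      using Suc.prems by (cases a) (simp_all add: Srj_club_iff)
    with Suc.prems have *: "length a' = n" "insert v (set a') = {..<m}"
      by (simp_all add: Srj_club_iff)
    from *(2) have "v < m" by blast
    then obtain m' where m: "m = Suc m'" by (cases m) simp_all
    with \<open>v < m\<close> have v: "v < Suc m'" by simp
    \<comment> \<open>If \<open>v\<close> recurs, the tail is already onto \<open>{..<m}\<close> and
      the head is merged in; otherwise \<open>v\<close> is the only value the tail misses, and
      closing up restores surjectivity.\<close>
    show ?case
    proof (cases "v \<in> set a'")
      case True
      with * have "a' \<in> Srj_club n m" by (simp add: Srj_club_iff insert_absorb)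
      then show ?thesis using insert_repeated_closed[OF assms \<open>v < m\<close> Suc.IH] a by simp
    next
      case False
      have "map (\<lambda>x. if x < v then x else x - 1) a' \<in> Srj_club n m'"
        unfolding Srj_club_iff set_map using * image_delete_value(2)[OF v False] m by simp
      then show ?thesis
        unfolding a m using *(2) m by (intro insert_fresh_closed[OF assms(1) v False _ Suc.IH]) blast+
    qed
  qed
  then show ?thesis by (auto simp: le_fun_def)
qed

text \<open>Insertion with merging asks nothing of the tail beyond being a map into the same
  codomain, so any list is built entry by entry from the empty map 0 \<rightarrow> m.\<close>

lemma Fun_club_le:
  assumes "[1, 0] \<in> G 2 2" "[0, 0] \<in> G 2 1" "[] \<in> G 0 1"
  shows "Fun_club \<le> G"
proof -
  have "a \<in> G n m" if "a \<in> Fun_club n m" for a n m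
    using that
  proof (induction n arbitrary: a)
    case 0
    then show ?case using empty_map_closed[OF assms(3)] by (auto simp: Fun_club_def)
  next
    case (Suc n)
    then obtain v a' where "a = v # a'" "v < m" "a' \<in> Fun_club n m"
      by (cases a) (auto simp: Fun_club_def)
    then show ?case using insert_repeated_closed[OF assms(1,2)] Suc.IH by simp
  qed
  then show ?thesis by (auto simp: le_fun_def)
qed

text \<open>No swap is available here. Instead, a strictly increasing list with head
  \<open>v\<close> is the sum of the empty map 0 \<rightarrow> v, the identity of 1, and the tail
  lowered by \<open>v + 1\<close>.\<close>

lemma Minj_club_le:
  assumes "[] \<in> G 0 1"
  shows "Minj_club \<le> G"
proof -
  have "a \<in> G n m" if "a \<in> Minj_club n m" for a n m
    using that
  proof (induction n arbitrary: a m)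
    case 0
    then show ?case using empty_map_closed[OF assms] by (auto simp: Minj_club_iff)
  next
    case (Suc n)
    then obtain v a' where a: "a = v # a'"
      by (cases a) (auto simp: Minj_club_iff)
    with Suc.prems have *: "length a' = n" "v < m" "\<forall>x\<in>set a'. v < x \<and> x < m" "sorted a'" "distinct a'"
      by (auto simp: Minj_club_iff le_less)
    let ?a = "map (\<lambda>x. x - Suc v) a'"
    have "?a \<in> Minj_club n (m - Suc v)"
    proof -
      have "inj_on (\<lambda>x. x - Suc v) (set a')"
        using * by (intro inj_on_diff_nat) (auto simp: Suc_le_eq)
      moreover have "sorted ?a"
        using *(4) by (auto simp: sorted_map intro: sorted_wrt_mono_rel diff_le_mono)
      moreover have "x - Suc v < m - Suc v" if "x \<in> set a'" for x
        using * that by (auto simp: diff_less_mono Suc_le_eq)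
      ultimately show ?thesis using * by (auto simp: Minj_club_iff distinct_map)
    qed
    then have "fun_plus v [] (fun_plus 1 (fun_id 1) ?a) \<in> G (0 + (1 + n)) (v + (1 + (m - Suc v)))"
      by (intro plus_closed empty_map_closed[OF assms] id_closed Suc.IH)
    moreover have "fun_plus v [] (fun_plus 1 (fun_id 1) ?a) = a"
      using * by (auto simp: a fun_plus_def fun_id_def intro!: map_idI)
    ultimately show ?case using *(2) by simp
  qed
  then show ?thesis by (auto simp: le_fun_def)
qed

end


section \<open>Combinators acting on multimorphisms\<close>

text \<open>These are the maps that arise when a morphism of arity \<open>k\<close> is substituted
  for the first variable in the laws of \<open>C\<close>, \<open>W\<close> and \<open>K\<close>, and
  variables for the others.\<close>

lemma wreath_fun_plus_id:
  "wreath [0, 2, 1] [k, 1, 1] = fun_plus k (fun_id k) [1, 0]"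
  "wreath [0, 1, 1] [k, 1] = fun_plus k (fun_id k) [0, 0]"
  "wreath [0] [k, 1] = fun_plus k (fun_id k) []"
  by (auto simp: wreath_def fun_plus_def fun_id_def map_idI)

section \<open>Application, substitution and the club action over the single object
  \<open>A\<close>\<close>

locale applicative_multicategory = club_multicategory S M
  for S :: map_class and M :: "('o, 'm, 'z) act_multicat_scheme" (structure) +
  fixes A :: 'o and ap :: 'm
  assumes applicative: "applicative_system M A ap"
begin

definition ops :: "nat \<Rightarrow> 'm set" where
  "ops k = hom M (replicate k A) A"

abbreviation one :: 'm where
  "one \<equiv> ident M A"

definition app :: "'m \<Rightarrow> 'm \<Rightarrow> 'm" where
  "app x y = mcomp M ap [x, y]"

text \<open>In the notation of combinatory terms this is \<open>x y_1 ... y_n\<close> with fresh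
  variables, placed after the variables that \<open>x\<close> itself may contain.\<close>

primrec apps :: "'m \<Rightarrow> nat \<Rightarrow> 'm" where
  "apps x 0 = x"
| "apps x (Suc n) = app (apps x n) one"

definition lift :: "nat \<Rightarrow> nat list \<Rightarrow> 'm \<Rightarrow> 'm" where
  "lift m a f = act M (replicate m A) a f"

lemma A_obj: "A \<in> obj M"
  using applicative by (simp add: applicative_system_def)

lemma set_replicate_A: "set (replicate n A) \<subseteq> obj M"
  using A_obj by auto

lemma opsD: "f \<in> ops k \<Longrightarrow> f \<in> mor M" "f \<in> ops k \<Longrightarrow> src M f = replicate k A"
  "f \<in> ops k \<Longrightarrow> tgt M f = A"
  by (auto simp: ops_def hom_def)

lemma one_ops: "one \<in> ops 1"
  using ident_hom[OF A_obj] by (simp add: ops_def)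

lemma ap_ops: "ap \<in> ops 2"
  using applicative by (simp add: ops_def applicative_system_def numeral_2_eq_2)

lemma mcomp_ops:
  assumes "f \<in> ops (length gs)" "length gs = length ks" "\<And>i. i < length gs \<Longrightarrow> gs ! i \<in> ops (ks ! i)"
  shows "mcomp M f gs \<in> ops (sum_list ks)"
proof -
  have "set gs \<subseteq> mor M"
    using assms(3) opsD(1) by (metis in_set_conv_nth subsetI)
  moreover have "map (tgt M) gs = src M f"
    by (auto simp: opsD(2)[OF assms(1)] opsD(3)[OF assms(3)] intro!: nth_equalityI)
  ultimately have h: "mcomp M f gs \<in> hom M (concat (map (src M) gs)) (tgt M f)"
    using mcomp_hom assms(1) opsD(1) by blast
  have "concat (map (src M) gs) = replicate (sum_list ks) A"
    using assms(2,3)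
  proof (induction gs ks rule: list_induct2)
    case (Cons g gs k ks)
    have "g \<in> ops k" using Cons.prems[of 0] by simp
    moreover have "concat (map (src M) gs) = replicate (sum_list ks) A"
      using Cons.prems[of "Suc _"] by (intro Cons.IH) simp
    ultimately show ?case by (simp add: opsD(2) replicate_add)
  qed simp
  with h show ?thesis using opsD(3)[OF assms(1)] by (simp add: ops_def)
qed

lemma app_ops:
  assumes "x \<in> ops k" "y \<in> ops l"
  shows "app x y \<in> ops (k + l)"
proof -
  have "mcomp M ap [x, y] \<in> ops (sum_list [k, l])"
    using assms ap_ops by (intro mcomp_ops) (auto simp: less_Suc_eq numeral_2_eq_2)
  then show ?thesis by (simp add: app_def)
qed

lemma apps_ops: "x \<in> ops k \<Longrightarrow> apps x n \<in> ops (k + n)"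
proof (induction n)
  case (Suc n)
  then show ?case using app_ops[OF _ one_ops] by fastforce
qed simp

lemma apps_add: "apps x (m + n) = apps (apps x m) n"
  by (induction n) auto

lemma apps_2: "apps x 2 = app (app x one) one"
  by (simp add: numeral_2_eq_2)

lemma apps_one_2: "apps one 2 \<in> ops 3"
  using apps_ops[OF one_ops, of 2] by (simp add: eval_nat_numeral)

lemma apps_app_one: "apps (app x one) n = apps x (Suc n)"
  using apps_add[of x 1 n] by simp

lemma app_one_one: "app one one = ap"
  using mcomp_ident_right[of ap] opsD[OF ap_ops] by (simp add: app_def numeral_2_eq_2)

lemma mcomp_one_right: "f \<in> ops k \<Longrightarrow> mcomp M f (replicate k one) = f"
  using mcomp_ident_right[of f] by (simp add: opsD)

lemma mcomp_one_left: "f \<in> ops k \<Longrightarrow> mcomp M one [f] = f"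
  using mcomp_ident_left[of f] by (simp add: opsD)

lemma ap_power_eq: "ap_power M A ap n = apps one n"
  by (induction n) (simp_all add: app_def)

text \<open>Associativity of composition, with the substituted list split between operator and
  operand.\<close>

lemma mcomp_app:
  assumes "x \<in> ops (length hs)" "y \<in> ops (length gs)"
    and "\<And>h. h \<in> set hs \<union> set gs \<Longrightarrow> h \<in> mor M \<and> tgt M h = A"
  shows "mcomp M (app x y) (hs @ gs) = app (mcomp M x hs) (mcomp M y gs)"
proof -
  have "mcomp M (mcomp M ap [x, y]) (concat [hs, gs]) = mcomp M ap (map2 (mcomp M) [x, y] [hs, gs])"
  proof (rule mcomp_assoc)
    fix i assume "i < length [x, y]"
    then have "i = 0 \<or> i = 1" by auto
    moreover have "map (tgt M) hs = replicate (length hs) A" "map (tgt M) gs = replicate (length gs) A"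
      using assms(3) by (simp_all add: map_eq_replicate)
    ultimately show "set ([hs, gs] ! i) \<subseteq> mor M \<and> map (tgt M) ([hs, gs] ! i) = src M ([x, y] ! i)"
      using assms by (auto simp: opsD)
  qed (use assms ap_ops in \<open>auto simp: opsD numeral_2_eq_2\<close>)
  then show ?thesis by (simp add: app_def)
qed

text \<open>The trailing variables of \<open>apps x n\<close> become actual arguments: peel off the
  last one with \<open>mcomp_app\<close> and use the left unit law for it.\<close>

lemma mcomp_apps:
  assumes "x \<in> ops (length hs)" "length gs = n"
    and "\<And>h. h \<in> set hs \<union> set gs \<Longrightarrow> h \<in> mor M \<and> tgt M h = A"
  shows "mcomp M (apps x n) (hs @ gs) = foldl app (mcomp M x hs) gs"
  using assms(2,3)
proof (induction n arbitrary: gs)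
  case (Suc n)
  then obtain gs' g where gs: "gs = gs' @ [g]" "length gs' = n"
    by (metis length_Suc_conv_rev)
  have "mcomp M (app (apps x n) one) ((hs @ gs') @ [g]) =
      app (mcomp M (apps x n) (hs @ gs')) (mcomp M one [g])"
    using apps_ops[OF assms(1), of n] one_ops gs Suc.prems(2) by (intro mcomp_app) auto
  also have "mcomp M one [g] = g"
    using mcomp_ident_left[of g] Suc.prems(2)[of g] gs by simp
  finally show ?case using Suc.IH[of gs'] Suc.prems(2) gs by simp
qed simp

lemma foldl_app_one: "foldl app x (replicate n one) = apps x n"
  by (induction n arbitrary: x) (auto simp: apps_app_one simp del: apps.simps(2))

lemma mcomp_apps_closed:
  assumes "c \<in> ops 0" "length gs = n" "\<forall>h\<in>set gs. h \<in> mor M \<and> tgt M h = A"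
  shows "mcomp M (apps c n) gs = foldl app c gs"
  using mcomp_apps[of c "[]" gs n] mcomp_one_right[OF assms(1)] assms by simp

lemma mcomp_apps_one:
  assumes "length gs = n" "\<forall>h\<in>set (g # gs). h \<in> mor M \<and> tgt M h = A"
  shows "mcomp M (apps one n) (g # gs) = foldl app g gs"
  using mcomp_apps[of one "[g]" gs n] mcomp_ident_left[of g] one_ops assms by simp

text \<open>Links the official form of computability with the shorter
  \<open>apps a n\<close>.\<close>

lemma ap_power_closed:
  assumes "a \<in> ops 0"
  shows "mcomp M (ap_power M A ap n) (a # replicate n one) = apps a n"
  using mcomp_apps[of one "[a]" "replicate n one" n] one_ops opsD[OF assms] opsD[OF one_ops]
  by (auto simp: ap_power_eq foldl_app_one mcomp_one_left[OF assms])

lemma computable_iff: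
  "computable M A ap f \<longleftrightarrow> (\<exists>n. f \<in> ops n \<and> (\<exists>a\<in>ops 0. apps a n = f))"
  unfolding computable_def ops_def[symmetric] by (auto simp: ap_power_closed ops_def[of 0, simplified, symmetric])

lemma lift_ops:
  assumes "a \<in> S n m" "f \<in> ops n"
  shows "lift m a f \<in> ops m"
  using act_hom[of a n "replicate m A" f A] assms set_replicate_A reindex_replicate[OF maps[OF assms(1)], of A]
  by (simp add: ops_def lift_def)

lemma lift_lift:
  assumes "a \<in> S n m" "b \<in> S m l" "f \<in> ops n"
  shows "lift l b (lift m a f) = lift l (fun_comp b a) f"
  using act_act[of a n m b "replicate l A" f A] assms set_replicate_A
    reindex_replicate[OF maps[OF assms(2)], of A]
    reindex_replicate[OF maps[OF comp_closed[OF assms(1,2)]], of A]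
  by (simp add: ops_def lift_def)

lemma lift_id: "f \<in> ops n \<Longrightarrow> lift n (fun_id n) f = f"
  using act_id[of f] by (simp add: opsD lift_def)

lemma app_lift:
  assumes "a \<in> S n m" "b \<in> S h k" "f \<in> ops n" "g \<in> ops h"
  shows "app (lift m a f) (lift k b g) = lift (m + k) (fun_plus m a b) (app f g)"
proof -
  \<comment> \<open>The axiom \<open>mcomp_act\<close> expects families indexed by position; for the
    two arguments of \<open>ap\<close> they are read off from two-element lists.\<close>
  define \<alpha> where "\<alpha> = nth [a, b]"
  define \<Delta> where "\<Delta> = nth [replicate m A, replicate k A]"
  define \<phi> where "\<phi> = nth [f, g]"
  have "mcomp M ap (map (\<lambda>i. act M (\<Delta> i) (\<alpha> i) (\<phi> i)) [0..<2]) =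
        act M (concat (map \<Delta> [0..<2])) (fun_sum (map (\<lambda>i. (length (\<Delta> i), \<alpha> i)) [0..<2]))
          (mcomp M ap (map \<phi> [0..<2]))"
  proof (rule mcomp_act[where ms = "nth [n, h]"])
    fix i :: nat assume "i < 2"
    then have "i = 0 \<or> i = 1" by auto
    then show "\<alpha> i \<in> S ([n, h] ! i) (length (\<Delta> i)) \<and> set (\<Delta> i) \<subseteq> obj M \<and>
        \<phi> i \<in> hom M (reindex (\<Delta> i) (\<alpha> i)) (src M ap ! i)"
      using assms A_obj reindex_replicate[OF maps[OF assms(1)], of A] reindex_replicate[OF maps[OF assms(2)], of A]
      by (auto simp: \<alpha>_def \<Delta>_def \<phi>_def opsD[OF ap_ops] numeral_2_eq_2 ops_def)
  qed (simp_all add: opsD[OF ap_ops])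
  then show ?thesis
    by (simp add: \<alpha>_def \<Delta>_def \<phi>_def numeral_2_eq_2 lift_def app_def replicate_add fun_plus_def)
qed

text \<open>Each trailing variable counts as \<open>one\<close> acted on by the identity map, so
  \<open>app_lift\<close> applies to it.\<close>

lemma apps_lift:
  assumes "a \<in> S n m" "f \<in> ops n"
  shows "apps (lift m a f) j = lift (m + j) (fun_plus m a (fun_id j)) (apps f j)"
proof (induction j)
  case 0
  show ?case by (simp add: fun_plus_def fun_id_def)
next
  case (Suc j)
  have "apps (lift m a f) (Suc j) =
      app (lift (m + j) (fun_plus m a (fun_id j)) (apps f j)) (lift 1 (fun_id 1) one)"
    using Suc.IH by (simp add: lift_id[OF one_ops, simplified])
  also have "\<dots> = lift (m + j + 1) (fun_plus (m + j) (fun_plus m a (fun_id j)) (fun_id 1)) (apps f (Suc j))"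
    using app_lift[OF plus_closed[OF assms(1) id_closed] id_closed apps_ops[OF assms(2)] one_ops] by simp
  also have "fun_plus (m + j) (fun_plus m a (fun_id j)) (fun_id 1) = fun_plus m a (fun_id (Suc j))"
    by (simp add: fun_plus_def fun_id_def)
  finally show ?case by simp
qed

lemma app_lift_right:
  assumes "a \<in> S n m" "f \<in> ops n" "x \<in> ops k"
  shows "app x (lift m a f) = lift (k + m) (fun_plus k (fun_id k) a) (app x f)"
  using app_lift[OF id_closed assms(1,3,2)] assms(3) by (simp add: lift_id)

lemma mcomp_lift:
  assumes "a \<in> S n m" "f \<in> ops n" "length gs = m"
    and "\<forall>g\<in>set gs. g \<in> mor M \<and> tgt M g = A"
  shows "mcomp M (lift m a f) gs =
    act M (concat (map (src M) gs)) (wreath a (map (\<lambda>f. length (src M f)) gs)) (mcomp M f (reindex gs a))"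
  unfolding lift_def
  using assms reindex_replicate[OF maps[OF assms(1)], of A]
  by (intro act_mcomp) (auto simp: ops_def map_eq_replicate)

end

section \<open>Realizable maps in the presence of \<open>B\<close> and \<open>I\<close>\<close>

locale BI_algebra = applicative_multicategory S M A ap
  for S :: map_class and M :: "('o, 'm, 'z) act_multicat_scheme" (structure) and A ap +
  fixes B I :: 'm
  assumes B_ops: "B \<in> ops 0" and B_law: "combinator_law M A ap CombB B"
    and I_ops: "I \<in> ops 0" and I_law: "combinator_law M A ap CombI I"
begin

text \<open>The law of \<open>B\<close> is an equation in three variables. Substituting
  \<open>x\<close>, \<open>y\<close>, \<open>z\<close> on both sides, where they occur in the same
  order, extends it to arguments with variables of their own.\<close>

lemma app_B:
  assumes "x \<in> ops k" "y \<in> ops l" "z \<in> ops m"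
  shows "app (app (app B x) y) z = app x (app y z)"
proof -
  have "mcomp M (ap_power M A ap 3) (B # replicate 3 one) = app one ap"
    using B_law by (simp add: app_def numeral_3_eq_3)
  then have "apps B 3 = app one ap"
    by (simp add: ap_power_closed[OF B_ops])
  moreover have "mcomp M (apps B 3) ([] @ [x, y, z]) = foldl app (mcomp M B []) [x, y, z]"
    using assms B_ops by (intro mcomp_apps) (auto simp: opsD)
  moreover have "mcomp M (app one ap) ([x] @ [y, z]) = app (mcomp M one [x]) (mcomp M ap [y, z])"
    using assms one_ops ap_ops by (intro mcomp_app) (auto simp: opsD numeral_2_eq_2)
  ultimately show ?thesis
    using mcomp_one_right[OF B_ops] mcomp_one_left[OF assms(1)] by (simp add: app_def[of y z])
qed

lemma app_I:
  assumes "x \<in> ops k"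
  shows "app I x = x"
proof -
  have "app I one = one" using I_law by (simp add: app_def)
  moreover have "mcomp M (app I one) ([] @ [x]) = app (mcomp M I []) (mcomp M one [x])"
    using assms I_ops one_ops by (intro mcomp_app) (auto simp: opsD)
  ultimately show ?thesis
    using mcomp_one_right[OF I_ops] mcomp_one_left[OF assms] by simp
qed

text \<open>The term \<open>B (B (... (B c)))\<close>. It postpones \<open>c\<close>: the argument
  first absorbs \<open>k\<close> further variables, and \<open>c\<close> is applied to the
  result.\<close>

definition shift :: "nat \<Rightarrow> 'm \<Rightarrow> 'm" where
  "shift k c = (app B ^^ k) c"

lemma shift_ops: "c \<in> ops 0 \<Longrightarrow> shift k c \<in> ops 0"
proof (induction k)
  case (Suc k)
  then show ?case using app_ops[OF B_ops] by (fastforce simp: shift_def)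
qed (simp add: shift_def)

lemma apps_shift:
  assumes "c \<in> ops 0" "x \<in> ops l"
  shows "apps (app (shift k c) x) k = app c (apps x k)"
  using assms(2)
proof (induction k arbitrary: x l)
  case 0
  then show ?case by (simp add: shift_def)
next
  case (Suc k)
  have "apps (app (shift (Suc k) c) x) (Suc k) = apps (app (app (app B (shift k c)) x) one) k"
    by (simp add: shift_def apps_app_one del: apps.simps(2))
  also have "\<dots> = apps (app (shift k c) (app x one)) k"
    using app_B[OF shift_ops[OF assms(1)] Suc.prems one_ops] by simp
  also have "\<dots> = app c (apps (app x one) k)"
    using Suc.IH[OF app_ops[OF Suc.prems one_ops]] .
  finally show ?case by (simp add: apps_app_one del: apps.simps(2))
qed

text \<open>The morphism \<open>g\<close> may have variables itself. They come first and stay fixed,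
  whence the summand \<open>fun_id k\<close>. Such open \<open>g\<close> occur when variables
  precede the block on which \<open>a\<close> acts.\<close>

definition realizes :: "'m \<Rightarrow> nat \<Rightarrow> nat \<Rightarrow> nat list \<Rightarrow> bool" where
  "realizes E p q a \<longleftrightarrow> (\<forall>k. \<forall>g \<in> ops k.
     apps (app E g) q = lift (k + q) (fun_plus k (fun_id k) a) (apps g p))"

definition realizable :: map_class where
  "realizable p q = {a \<in> S p q. \<exists>E \<in> ops 0. realizes E p q a}"

lemma realizable_id: "fun_id n \<in> realizable n n"
  using I_ops id_closed[of n]
  by (auto simp: realizable_def realizes_def app_I fun_plus_id_id lift_id apps_ops intro!: bexI[of _ I])

lemma realizable_comp:
  assumes "a \<in> realizable n m" "b \<in> realizable m l"
  shows "fun_comp b a \<in> realizable n l"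
proof -
  obtain E F where a: "a \<in> S n m" "E \<in> ops 0" "realizes E n m a"
    and b: "b \<in> S m l" "F \<in> ops 0" "realizes F m l b"
    using assms by (auto simp: realizable_def)
  \<comment> \<open>\<open>B F E g = F (E g)\<close>: first \<open>E\<close> arranges the arguments
    by \<open>a\<close>, then \<open>F\<close> by \<open>b\<close>, and the two actions
    compose.\<close>
  have "realizes (app (app B F) E) n l (fun_comp b a)"
    unfolding realizes_def
  proof (intro allI ballI)
    fix k g assume g: "g \<in> ops k"
    have "apps (app (app (app B F) E) g) l = apps (app F (app E g)) l"
      using app_B[OF b(2) a(2) g] by simp
    also have "\<dots> = lift (k + l) (fun_plus k (fun_id k) b) (apps (app E g) m)"
      using b(3) app_ops[OF a(2) g] by (simp add: realizes_def)
    also have "\<dots> = lift (k + l) (fun_plus k (fun_id k) b) (lift (k + m) (fun_plus k (fun_id k) a) (apps g n))"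
      using a(3) g by (simp add: realizes_def)
    also have "\<dots> = lift (k + l) (fun_comp (fun_plus k (fun_id k) b) (fun_plus k (fun_id k) a)) (apps g n)"
      by (rule lift_lift[OF plus_closed[OF id_closed a(1)] plus_closed[OF id_closed b(1)] apps_ops[OF g]])
    also have "fun_comp (fun_plus k (fun_id k) b) (fun_plus k (fun_id k) a) =
        fun_plus k (fun_id k) (fun_comp b a)"
      using maps[OF a(1)] maps[OF b(1)] by (intro fun_comp_fun_plus_id) (auto simp: Fun_club_def)
    finally show "apps (app (app (app B F) E) g) l =
        lift (k + l) (fun_plus k (fun_id k) (fun_comp b a)) (apps g n)" .
  qed
  moreover have "app (app B F) E \<in> ops 0"
    using app_ops[OF app_ops[OF B_ops b(2)] a(2)] by simp
  ultimately show ?thesis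
    using comp_closed[OF a(1) b(1)] by (auto simp: realizable_def)
qed

text \<open>The same \<open>E\<close> serves: after \<open>m\<close> variables its work is done, and
  \<open>j\<close> more are merely appended.\<close>

lemma realizable_plus_id:
  assumes "a \<in> realizable n m"
  shows "fun_plus m a (fun_id j) \<in> realizable (n + j) (m + j)"
proof -
  obtain E where a: "a \<in> S n m" "E \<in> ops 0" "realizes E n m a"
    using assms by (auto simp: realizable_def)
  have "realizes E (n + j) (m + j) (fun_plus m a (fun_id j))"
    unfolding realizes_def
  proof (intro allI ballI)
    fix k g assume g: "g \<in> ops k"
    have "apps (app E g) (m + j) = apps (lift (k + m) (fun_plus k (fun_id k) a) (apps g n)) j"
      using a(3) g by (simp add: realizes_def apps_add)
    also have "\<dots> = lift (k + m + j) (fun_plus (k + m) (fun_plus k (fun_id k) a) (fun_id j)) (apps (apps g n) j)"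
      by (rule apps_lift[OF plus_closed[OF id_closed a(1)] apps_ops[OF g]])
    finally show "apps (app E g) (m + j) =
        lift (k + (m + j)) (fun_plus k (fun_id k) (fun_plus m a (fun_id j))) (apps g (n + j))"
      by (simp add: fun_plus_assoc apps_add add.assoc)
  qed
  then show ?thesis
    using plus_closed[OF a(1) id_closed] a(2) by (auto simp: realizable_def)
qed

text \<open>The first \<open>j\<close> variables are to be left alone, so \<open>E\<close> is
  postponed by \<open>shift j\<close> and acts with \<open>apps g j\<close> in the role of
  \<open>g\<close>.\<close>

lemma realizable_id_plus:
  assumes "a \<in> realizable n m"
  shows "fun_plus j (fun_id j) a \<in> realizable (j + n) (j + m)"
proof -
  obtain E where a: "a \<in> S n m" "E \<in> ops 0" "realizes E n m a"
    using assms by (auto simp: realizable_def)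
  have "realizes (shift j E) (j + n) (j + m) (fun_plus j (fun_id j) a)"
    unfolding realizes_def
  proof (intro allI ballI)
    fix k g assume g: "g \<in> ops k"
    have "apps (app (shift j E) g) (j + m) = apps (app E (apps g j)) m"
      using apps_shift[OF a(2) g] by (simp add: apps_add)
    also have "\<dots> = lift (k + j + m) (fun_plus (k + j) (fun_id (k + j)) a) (apps (apps g j) n)"
      using a(3) apps_ops[OF g] by (simp add: realizes_def)
    finally show "apps (app (shift j E) g) (j + m) =
        lift (k + (j + m)) (fun_plus k (fun_id k) (fun_plus j (fun_id j) a)) (apps g (j + n))"
      by (simp add: fun_plus_id_fun_plus apps_add add.assoc)
  qed
  then show ?thesis
    using plus_closed[OF id_closed a(1)] shift_ops[OF a(2)] by (auto simp: realizable_def)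
qed

sublocale realizable: pro realizable
proof
  fix a b n m h k
  show "a \<in> Fun_club n m" if "a \<in> realizable n m"
    using that maps by (auto simp: realizable_def)
  \<comment> \<open>Factor the sum as \<open>b\<close> beside an identity, followed by
    \<open>a\<close> beside an identity.\<close>
  then show "fun_plus m a b \<in> realizable (n + h) (m + k)"
    if "a \<in> realizable n m" "b \<in> realizable h k"
    using realizable_comp[OF realizable_id_plus[OF that(2)] realizable_plus_id[OF that(1)]]
      fun_plus_eq_comp[of a n m b h k] that maps by (simp add: realizable_def)
qed (use realizable_id realizable_comp in auto)

section \<open>Uniformly computable morphisms\<close>

text \<open>
  Without \<open>C\<close> the computable morphisms need not be closed under composition, since the closed
  element of an inner morphism cannot be moved to the front past earlier arguments. The head \<open>x\<close>
  avoids this.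
\<close>

definition uniform :: "nat \<Rightarrow> 'm set" where
  "uniform n = {f \<in> ops n. \<exists>c \<in> ops 0. \<forall>k. \<forall>x \<in> ops k. apps (app c x) n = app x f}"

lemma uniform_computable: "f \<in> uniform n \<Longrightarrow> computable M A ap f"
proof -
  assume "f \<in> uniform n"
  then obtain c where "f \<in> ops n" "c \<in> ops 0" "apps (app c I) n = app I f"
    using I_ops by (auto simp: uniform_def)
  then show ?thesis
    using app_ops[OF _ I_ops, of c 0] app_I by (auto simp: computable_iff)
qed

lemma uniform_one: "one \<in> uniform 1"
  using one_ops I_ops by (auto simp: uniform_def app_I intro!: bexI[of _ I])

text \<open>The witness is \<open>B\<close> itself, since \<open>B x y z = x (y z)\<close>.\<close>

lemma uniform_ap: "ap \<in> uniform 2"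
  using app_B[OF _ one_ops one_ops] ap_ops B_ops
  by (auto simp: uniform_def app_one_one numeral_2_eq_2 intro!: bexI[of _ B])

text \<open>The witness is \<open>B E c\<close>: applied to \<open>x\<close> it gives
  \<open>E (c x)\<close>, where \<open>c\<close> produces \<open>x f\<close> and \<open>E\<close>
  rearranges the variables of \<open>f\<close> behind those of \<open>x\<close>.\<close>

lemma uniform_lift:
  assumes "a \<in> realizable n m" "f \<in> uniform n"
  shows "lift m a f \<in> uniform m"
proof -
  obtain E where a: "a \<in> S n m" "E \<in> ops 0" "realizes E n m a"
    using assms by (auto simp: realizable_def)
  obtain c where f: "f \<in> ops n" "c \<in> ops 0" "\<And>k x. x \<in> ops k \<Longrightarrow> apps (app c x) n = app x f"
    using assms(2) by (auto simp: uniform_def)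
  have "apps (app (app (app B E) c) x) m = app x (lift m a f)" if x: "x \<in> ops k" for k x
  proof -
    have "apps (app (app (app B E) c) x) m = apps (app E (app c x)) m"
      using app_B[OF a(2) f(2) x] by simp
    also have "\<dots> = lift (k + m) (fun_plus k (fun_id k) a) (apps (app c x) n)"
      using a(3) app_ops[OF f(2) x] by (simp add: realizes_def)
    finally show ?thesis
      using f(3)[OF x] app_lift_right[OF a(1) f(1) x] by simp
  qed
  moreover have "app (app B E) c \<in> ops 0"
    using app_ops[OF app_ops[OF B_ops a(2)] f(2)] by simp
  ultimately show ?thesis
    using lift_ops[OF a(1) f(1)] by (auto simp: uniform_def)
qed

text \<open>The arguments of \<open>c x\<close> are replaced one after another by the
  \<open>gs\<close>, each reading its own block of variables.\<close>

lemma foldl_app_uniform: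
  assumes "c \<in> ops 0" "length gs = length ks" "\<And>i. i < length gs \<Longrightarrow> gs ! i \<in> uniform (ks ! i)"
  shows "\<exists>d \<in> ops 0. \<forall>k. \<forall>x \<in> ops k. apps (app d x) (sum_list ks) = foldl app (app c x) gs"
  using assms(2,3)
proof (induction gs arbitrary: ks rule: rev_induct)
  case Nil
  then show ?case using assms(1) by auto
next
  case (snoc g gs)
  obtain l ks' where ks: "ks = ks' @ [l]" "length gs = length ks'"
    using snoc.prems(1) by (metis length_Suc_conv_rev length_append_singleton nat.inject)
  have "g \<in> uniform l"
    using snoc.prems(2)[of "length gs"] ks by (simp add: nth_append)
  then obtain e where e: "e \<in> ops 0" "\<And>k x. x \<in> ops k \<Longrightarrow> apps (app e x) l = app x g"
    by (auto simp: uniform_def)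
  have "gs ! i \<in> uniform (ks' ! i)" if "i < length gs" for i
    using snoc.prems(2)[of i] ks that by (simp add: nth_append)
  then obtain d where d: "d \<in> ops 0"
    "\<And>k x. x \<in> ops k \<Longrightarrow> apps (app d x) (sum_list ks') = foldl app (app c x) gs"
    using snoc.IH[OF ks(2)] by auto
  \<comment> \<open>\<open>d x\<close> consumes the blocks of the earlier arguments;
    \<open>e\<close>, postponed past them, then turns the last \<open>l\<close> variables into the
    argument \<open>g\<close>. The head passed to \<open>e\<close> is an open term, which is why
    uniformity must cover \<open>x\<close> of every arity.\<close>
  let ?d = "app (app B (shift (sum_list ks') e)) d"
  have "apps (app ?d x) (sum_list ks) = foldl app (app c x) (gs @ [g])" if x: "x \<in> ops k" for k x
  proof -
    have "apps (app ?d x) (sum_list ks) = apps (apps (app (shift (sum_list ks') e) (app d x)) (sum_list ks')) l"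
      using app_B[OF shift_ops[OF e(1)] d(1) x] by (simp add: ks apps_add)
    also have "\<dots> = apps (app e (apps (app d x) (sum_list ks'))) l"
      using apps_shift[OF e(1) app_ops[OF d(1) x]] by simp
    also have "\<dots> = app (apps (app d x) (sum_list ks')) g"
      using e(2)[OF apps_ops[OF app_ops[OF d(1) x]]] .
    finally show ?thesis using d(2)[OF x] by simp
  qed
  moreover have "?d \<in> ops 0"
    using app_ops[OF app_ops[OF B_ops shift_ops[OF e(1)]] d(1)] by simp
  ultimately show ?case by blast
qed

text \<open>In the equation \<open>c x y_1 ... y_n = x f\<close>, keep the variables of
  \<open>x\<close> and substitute \<open>gs\<close> for the others. The right side becomes
  \<open>x\<close> applied to the composite, and the left side is supplied by
  \<open>foldl_app_uniform\<close>.\<close>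

lemma uniform_mcomp:
  assumes "f \<in> uniform n" "length gs = n" "length ks = n"
    "\<And>i. i < n \<Longrightarrow> gs ! i \<in> uniform (ks ! i)"
  shows "mcomp M f gs \<in> uniform (sum_list ks)"
proof -
  obtain c where f: "f \<in> ops n" "c \<in> ops 0" "\<And>k x. x \<in> ops k \<Longrightarrow> apps (app c x) n = app x f"
    using assms(1) by (auto simp: uniform_def)
  have gs_ops: "gs ! i \<in> ops (ks ! i)" if "i < n" for i
    using assms(4)[OF that] by (simp add: uniform_def)
  then have gs: "g \<in> mor M \<and> tgt M g = A" if "g \<in> set gs" for g
    using that assms(2) opsD(1,3) by (metis in_set_conv_nth)
  obtain d where d: "d \<in> ops 0"
    "\<And>k x. x \<in> ops k \<Longrightarrow> apps (app d x) (sum_list ks) = foldl app (app c x) gs"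
    using foldl_app_uniform[OF f(2), of gs ks] assms by auto
  have "apps (app d x) (sum_list ks) = app x (mcomp M f gs)" if x: "x \<in> ops k" for k x
  proof -
    have ids: "h \<in> mor M \<and> tgt M h = A" if "h \<in> set (replicate k one) \<union> set gs" for h
      using that gs opsD[OF one_ops] by auto
    have cx: "app c x \<in> ops k" using app_ops[OF f(2) x] by simp
    have "foldl app (app c x) gs = mcomp M (apps (app c x) n) (replicate k one @ gs)"
      using mcomp_apps[of "app c x" "replicate k one" gs n] ids cx assms(2)
      by (simp add: mcomp_one_right)
    also have "\<dots> = mcomp M (app x f) (replicate k one @ gs)"
      using f(3)[OF x] by simp
    also have "\<dots> = app x (mcomp M f gs)"
      using mcomp_app[of x "replicate k one" f gs] ids x f(1) assms(2)
      by (simp add: mcomp_one_right)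
    finally show ?thesis using d(2)[OF x] by simp
  qed
  moreover have "mcomp M f gs \<in> ops (sum_list ks)"
    using f(1) gs_ops assms by (intro mcomp_ops) auto
  ultimately show ?thesis using d(1) by (auto simp: uniform_def)
qed

lemma generated_subset_uniform:
  assumes "S' \<le> realizable"
  shows "generated_morphisms S' M ap \<subseteq> (\<Union>n. uniform n)"
proof -
  have uniform_ops: "f \<in> uniform n \<Longrightarrow> f \<in> ops n" for f n
    by (simp add: uniform_def)
  \<comment> \<open>The uniform morphisms form a substructure with the single object
    \<open>A\<close>; as it contains \<open>ap\<close>, it contains everything generated.\<close>
  have "sub_club_multicategory S' M {A} (\<Union>n. uniform n)"
    unfolding sub_club_multicategory_def
  proof (intro conjI ballI allI impI)
    fix f gs assume "f \<in> (\<Union>n. uniform n)" and gs: "set gs \<subseteq> (\<Union>n. uniform n) \<and> map (tgt M) gs = src M f"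
    then obtain n where f: "f \<in> uniform n" by blast
    then have "length gs = n"
      using gs opsD(2)[OF uniform_ops[OF f]] by (metis length_map length_replicate)
    \<comment> \<open>Membership in the union gives each member of \<open>gs\<close> an arity,
      chosen here as a function of the morphism.\<close>
    moreover obtain \<kappa> where "\<And>g. g \<in> set gs \<Longrightarrow> g \<in> uniform (\<kappa> g)"
      using gs by (metis (no_types) UN_iff subset_iff)
    ultimately have "mcomp M f gs \<in> uniform (sum_list (map \<kappa> gs))"
      using f by (intro uniform_mcomp) auto
    then show "mcomp M f gs \<in> (\<Union>n. uniform n)" by blast
  next
    fix f m a Ds assume "f \<in> (\<Union>n. uniform n)"
      and a: "a \<in> S' m (length Ds) \<and> set Ds \<subseteq> {A} \<and> src M f = reindex Ds a"
    then obtain n where f: "f \<in> uniform n" by blast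
    have Ds: "Ds = replicate (length Ds) A"
      using a by (metis replicate_length_same singletonD subset_iff)
    have "a \<in> realizable m (length Ds)"
      using assms a by (auto simp: le_fun_def)
    moreover from this have "n = m"
      using a opsD(2)[OF uniform_ops[OF f]] realizable.maps
      by (metis (mono_tags, lifting) Fun_club_def length_reindex length_replicate mem_Collect_eq)
    ultimately show "act M Ds a f \<in> (\<Union>n. uniform n)"
      using uniform_lift[of a m "length Ds" f] f Ds by (auto simp: lift_def)
  qed (use A_obj uniform_one opsD[OF uniform_ops] in auto)
  then show ?thesis
    using uniform_ap by (auto simp: generated_morphisms_def)
qed

lemma weakly_complete:
  assumes "S' \<le> realizable"
  shows "weakly_combinatory_complete S' M A ap"
  using generated_subset_uniform[OF assms] uniform_computable
  by (auto simp: weakly_combinatory_complete_def)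

section \<open>The elementary maps realized by \<open>C\<close>, \<open>W\<close> and
  \<open>K\<close>\<close>

lemma realizable_swap:
  assumes "[1, 0] \<in> S 2 2" "[0, 2, 1] \<in> S 3 3" "C \<in> ops 0" "combinator_law M A ap CombC C"
  shows "[1, 0] \<in> realizable 2 2"
proof -
  have apps3: "apps C 3 = act M (replicate 3 A) [0, 2, 1] (apps one 2)"
    using assms(4) ap_power_closed[OF assms(3), of 3]
    by (simp only: combinator_law.simps tau_3_2 ap_power_eq replicate_2_3)
  have "realizes C 2 2 [1, 0]"
    unfolding realizes_def
  proof (intro allI ballI)
    fix k g assume g: "g \<in> ops k"
    note gs = opsD[OF g] opsD[OF one_ops]
    have "apps (app C g) 2 = mcomp M (apps C 3) [g, one, one]"
      using mcomp_apps_closed[OF assms(3), of "[g, one, one]" 3] gs by (simp add: apps_2)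
    \<comment> \<open>Substituting \<open>g\<close> turns the first position into a block of size
      \<open>k\<close>, while the other two keep size 1; the wreath product therefore fixes the
      block and swaps the last two points.\<close>
    also have "\<dots> = act M (replicate (k + 2) A) (fun_plus k (fun_id k) [1, 0])
        (mcomp M (apps one 2) [g, one, one])"
      using mcomp_lift[OF assms(2) apps_one_2, of "[g, one, one]"] gs wreath_fun_plus_id(1)[of k]
      by (simp add: apps3 reindex_def lift_def replicate_append_same replicate_app_Cons_same replicate_2_3)
    also have "mcomp M (apps one 2) [g, one, one] = apps g 2"
      using mcomp_apps_one[of "[one, one]" 2 g] gs by (simp add: apps_2)
    finally show "apps (app C g) 2 = lift (k + 2) (fun_plus k (fun_id k) [1, 0]) (apps g 2)"
      by (simp add: lift_def)
  qed
  then show ?thesis using assms by (auto simp: realizable_def)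
qed

lemma realizable_merge:
  assumes "[0, 0] \<in> S 2 1" "[0, 1, 1] \<in> S 3 2" "W \<in> ops 0" "combinator_law M A ap CombW W"
  shows "[0, 0] \<in> realizable 2 1"
proof -
  have apps2: "apps W 2 = act M (replicate 2 A) [0, 1, 1] (apps one 2)"
    using assms(4) ap_power_closed[OF assms(3), of 2]
    by (simp only: combinator_law.simps sigma_2_2 ap_power_eq replicate_2_3)
  have "realizes W 2 1 [0, 0]"
    unfolding realizes_def
  proof (intro allI ballI)
    fix k g assume g: "g \<in> ops k"
    note gs = opsD[OF g] opsD[OF one_ops]
    have "apps (app W g) 1 = mcomp M (apps W 2) [g, one]"
      using mcomp_apps_closed[OF assms(3), of "[g, one]" 2] gs by (simp add: apps_2)
    also have "\<dots> = act M (replicate (k + 1) A) (fun_plus k (fun_id k) [0, 0])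
        (mcomp M (apps one 2) [g, one, one])"
      using mcomp_lift[OF assms(2) apps_one_2, of "[g, one]"] gs wreath_fun_plus_id(2)[of k]
      by (simp add: apps2 reindex_def lift_def replicate_append_same replicate_app_Cons_same replicate_2_3)
    also have "mcomp M (apps one 2) [g, one, one] = apps g 2"
      using mcomp_apps_one[of "[one, one]" 2 g] gs by (simp add: apps_2)
    finally show "apps (app W g) 1 = lift (k + 1) (fun_plus k (fun_id k) [0, 0]) (apps g 2)"
      by (simp add: lift_def)
  qed
  then show ?thesis using assms by (auto simp: realizable_def)
qed

lemma realizable_drop:
  assumes "[] \<in> S 0 1" "[0] \<in> S 1 2" "K \<in> ops 0" "combinator_law M A ap CombK K"
  shows "[] \<in> realizable 0 1"
proof -
  have apps2: "apps K 2 = act M (replicate 2 A) [0] one"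
    using assms(4) ap_power_closed[OF assms(3), of 2]
    by (simp only: combinator_law.simps delta_2_2 ap_power_eq replicate_2_3)
  have "realizes K 0 1 []"
    unfolding realizes_def
  proof (intro allI ballI)
    fix k g assume g: "g \<in> ops k"
    note gs = opsD[OF g] opsD[OF one_ops]
    have "apps (app K g) 1 = mcomp M (apps K 2) [g, one]"
      using mcomp_apps_closed[OF assms(3), of "[g, one]" 2] gs by (simp add: apps_2)
    \<comment> \<open>The map \<open>[0]\<close> selects only \<open>g\<close> from the two
      arguments, and the point it misses becomes a dummy variable after those of
      \<open>g\<close>.\<close>
    also have "\<dots> = act M (replicate (k + 1) A) (fun_plus k (fun_id k) []) (mcomp M one [g])"
      using mcomp_lift[OF assms(2) one_ops, of "[g, one]"] gs wreath_fun_plus_id(3)[of k]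
      by (simp add: apps2 reindex_def lift_def replicate_append_same replicate_app_Cons_same replicate_2_3)
    finally show "apps (app K g) 1 = lift (k + 1) (fun_plus k (fun_id k) []) (apps g 0)"
      using mcomp_one_left[OF g] by (simp add: lift_def)
  qed
  then show ?thesis using assms by (auto simp: realizable_def)
qed

end

section \<open>From completeness to combinators\<close>

context applicative_multicategory
begin

text \<open>Computability leaves the arity existential; the length of the source pins it down to
  \<open>n\<close>.\<close>

lemma complete_generated:
  assumes "weakly_combinatory_complete S' M A ap" "f \<in> generated_morphisms S' M ap" "f \<in> ops n"
  shows "\<exists>a \<in> hom M [] A. mcomp M (ap_power M A ap n) (a # replicate n one) = f"
proof -
  obtain m a where "f \<in> ops m" "a \<in> ops 0" "apps a m = f"
    using assms(1,2) by (auto simp: weakly_combinatory_complete_def computable_iff)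
  moreover from this have "m = n"
    using opsD(2)[of f m] opsD(2)[OF assms(3)] by (metis length_replicate)
  ultimately show ?thesis
    using ap_power_closed by (auto simp: ops_def)
qed

lemma generated_ap: "ap \<in> generated_morphisms S' M ap"
  by (auto simp: generated_morphisms_def)

lemma sub_containing_ap:
  assumes "sub_club_multicategory S' M Os Fs" "ap \<in> Fs"
  shows "A \<in> Os" "one \<in> Fs"
proof -
  show "A \<in> Os" using assms opsD(3)[OF ap_ops] by (auto simp: sub_club_multicategory_def)
  then show "one \<in> Fs" using assms by (auto simp: sub_club_multicategory_def)
qed

lemma generated_one: "one \<in> generated_morphisms S' M ap"
  using sub_containing_ap by (auto simp: generated_morphisms_def)

lemma generated_mcomp:
  assumes "f \<in> generated_morphisms S' M ap" "set gs \<subseteq> generated_morphisms S' M ap"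
    and "map (tgt M) gs = src M f"
  shows "mcomp M f gs \<in> generated_morphisms S' M ap"
  unfolding generated_morphisms_def
proof (intro InterI, clarify)
  fix Fs Os assume Fs: "sub_club_multicategory S' M Os Fs" "ap \<in> Fs"
  then have "f \<in> Fs" "set gs \<subseteq> Fs"
    using assms(1,2) by (auto simp: generated_morphisms_def)
  then show "mcomp M f gs \<in> Fs"
    using Fs(1) assms(3) by (simp add: sub_club_multicategory_def)
qed

text \<open>Every substructure containing \<open>ap\<close> has \<open>A\<close> among its objects,
  so the source \<open>replicate m A\<close> is admissible in each member of the
  intersection.\<close>

lemma generated_act:
  assumes "f \<in> generated_morphisms S' M ap" "a \<in> S' n m" "src M f = reindex (replicate m A) a"
  shows "act M (replicate m A) a f \<in> generated_morphisms S' M ap"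
  unfolding generated_morphisms_def
proof (intro InterI, clarify)
  fix Fs Os assume Fs: "sub_club_multicategory S' M Os Fs" "ap \<in> Fs"
  have "\<forall>f\<in>Fs. \<forall>m a Ds. a \<in> S' m (length Ds) \<and> set Ds \<subseteq> Os \<and> src M f = reindex Ds a \<longrightarrow> act M Ds a f \<in> Fs"
    using Fs(1) unfolding sub_club_multicategory_def by blast
  moreover have "f \<in> Fs" "set (replicate m A) \<subseteq> Os"
    using Fs assms(1) sub_containing_ap(1)[OF Fs] by (auto simp: generated_morphisms_def)
  ultimately show "act M (replicate m A) a f \<in> Fs"
    using assms(2,3) by (metis length_replicate)
qed

lemma generated_apps_one: "apps one n \<in> generated_morphisms S' M ap"
proof (induction n)
  case 0
  show ?case by (simp add: generated_one)
next
  case (Suc n)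
  then show ?case
    using generated_mcomp[OF generated_ap, of "[apps one n, one]" S'] generated_one
      opsD[OF ap_ops] opsD[OF apps_ops[OF one_ops, of n]] opsD[OF one_ops]
    by (simp add: app_def replicate_2_3)
qed

text \<open>The right side of the law is composed from \<open>ap\<close> and an identity, so it is
  generated; an element computing it is a \<open>B\<close>.\<close>

lemma complete_CombB:
  assumes "weakly_combinatory_complete S' M A ap"
  shows "\<exists>x \<in> hom M [] A. combinator_law M A ap CombB x"
proof -
  have "mcomp M ap [one, ap] \<in> generated_morphisms S' M ap"
    using opsD[OF one_ops] opsD[OF ap_ops]
    by (intro generated_mcomp generated_ap) (auto simp: generated_ap generated_one replicate_2_3)
  moreover have "mcomp M ap [one, ap] \<in> ops 3"
    using app_ops[OF one_ops ap_ops] by (simp add: app_def eval_nat_numeral)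
  ultimately show ?thesis
    using complete_generated[OF assms] by (fastforce simp only: combinator_law.simps replicate_2_3)
qed

lemma complete_CombI:
  assumes "weakly_combinatory_complete S' M A ap"
  shows "\<exists>x \<in> hom M [] A. combinator_law M A ap CombI x"
proof -
  \<comment> \<open>With this, the law of \<open>I\<close> says exactly that the identity is
    computed by \<open>I\<close>.\<close>
  have "ap_power M A ap 1 = ap"
    using app_one_one by (simp add: app_def)
  then show ?thesis
    using complete_generated[OF assms generated_one one_ops] by simp
qed

text \<open>The laws of \<open>C\<close>, \<open>W\<close> and \<open>K\<close> all have such an
  action on their right side, with \<open>f\<close> either \<open>apps one 2\<close> or
  \<open>one\<close>.\<close>

lemma complete_lift:
  assumes "weakly_combinatory_complete S' M A ap" "S' \<le> S" "a \<in> S' n m" "f \<in> ops n"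
    and "f \<in> generated_morphisms S' M ap"
  shows "\<exists>x \<in> hom M [] A. mcomp M (ap_power M A ap m) (x # replicate m one) = act M (replicate m A) a f"
proof -
  have a: "a \<in> S n m" using assms(2,3) by (auto simp: le_fun_def)
  then show ?thesis
    using lift_ops[OF a assms(4)] opsD(2)[OF assms(4)] reindex_replicate[OF maps[OF a], of A]
    by (intro complete_generated[OF assms(1)] generated_act[OF assms(5,3)]) (simp_all add: lift_def)
qed

lemma complete_CombC:
  assumes "weakly_combinatory_complete S' M A ap" "S' \<le> S" "[0, 2, 1] \<in> S' 3 3"
  shows "\<exists>x \<in> hom M [] A. combinator_law M A ap CombC x"
  using complete_lift[OF assms apps_one_2 generated_apps_one]
  by (simp add: ap_power_eq tau_3_2 replicate_2_3)

lemma complete_CombW: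
  assumes "weakly_combinatory_complete S' M A ap" "S' \<le> S" "[0, 1, 1] \<in> S' 3 2"
  shows "\<exists>x \<in> hom M [] A. combinator_law M A ap CombW x"
  using complete_lift[OF assms apps_one_2 generated_apps_one]
  by (simp add: ap_power_eq sigma_2_2 replicate_2_3)

lemma complete_CombK:
  assumes "weakly_combinatory_complete S' M A ap" "S' \<le> S" "[0] \<in> S' 1 2"
  shows "\<exists>x \<in> hom M [] A. combinator_law M A ap CombK x"
  using complete_lift[OF assms one_ops generated_one]
  by (simp add: ap_power_eq delta_2_2 replicate_2_3)

end

theorem theorem3p10:
  fixes S :: map_class
    and M :: "('o, 'm, 'z) act_multicat_scheme"
    and A :: 'o and ap :: 'm
  assumes "faithful_cartesian_club S"
    and "club_multicategory S M"
    and "applicative_system M A ap"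
  shows "(Bij_club \<le> S \<longrightarrow>
           (weakly_combinatory_complete Bij_club M A ap \<longleftrightarrow>
            combinator_algebra M A ap {CombB, CombC, CombI}))
       \<and> (Minj_club \<le> S \<longrightarrow>
           (weakly_combinatory_complete Minj_club M A ap \<longleftrightarrow>
            combinator_algebra M A ap {CombB, CombK, CombI}))
       \<and> (Inj_club \<le> S \<longrightarrow>
           (weakly_combinatory_complete Inj_club M A ap \<longleftrightarrow>
            combinator_algebra M A ap {CombB, CombC, CombK, CombI}))
       \<and> (Srj_club \<le> S \<longrightarrow>
           (weakly_combinatory_complete Srj_club M A ap \<longleftrightarrow>
            combinator_algebra M A ap {CombB, CombC, CombW, CombI}))
       \<and> (S = Fun_club \<longrightarrow>
           (weakly_combinatory_complete Fun_club M A ap \<longleftrightarrow>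
            combinator_algebra M A ap {CombB, CombC, CombK, CombW, CombI}))"
proof -
  interpret applicative_multicategory S M A ap
    using assms(2,3) by (simp add: applicative_multicategory_def applicative_multicategory_axioms_def)
  \<comment> \<open>Existence of each combinator becomes a proposition, so that the five
    equivalences reduce to propositional reasoning.\<close>
  define has where "has c \<longleftrightarrow> (\<exists>x \<in> hom M [] A. combinator_law M A ap c x)" for c
  have alg: "combinator_algebra M A ap H \<longleftrightarrow> (\<forall>c\<in>H. has c)" for H
    by (simp add: combinator_algebra_def has_def)

  note Bij = Bij_club_iff and Inj = Inj_club_iff and Minj = Minj_club_iff and Srj = Srj_club_iff
  have lessThans: "{..<1} = {0::nat}" "{..<2} = {0::nat, 1}" "{..<3} = {0::nat, 2, 1}"
    by auto
  have swap: "[1, 0] \<in> Bij_club 2 2" "[1, 0] \<in> Inj_club 2 2" "[1, 0] \<in> Srj_club 2 2" "[1, 0] \<in> Fun_club 2 2"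
    and swap3: "[0, 2, 1] \<in> Bij_club 3 3" "[0, 2, 1] \<in> Inj_club 3 3" "[0, 2, 1] \<in> Srj_club 3 3" "[0, 2, 1] \<in> Fun_club 3 3"
    unfolding Bij Inj Srj Fun_club_def lessThans by auto
  have drop: "[] \<in> Minj_club 0 1" "[] \<in> Inj_club 0 1" "[] \<in> Fun_club 0 1"
    and drop2: "[0] \<in> Minj_club 1 2" "[0] \<in> Inj_club 1 2" "[0] \<in> Fun_club 1 2"
    unfolding Minj Inj Fun_club_def lessThans by auto
  have merge: "[0, 0] \<in> Srj_club 2 1" "[0, 0] \<in> Fun_club 2 1"
    and merge3: "[0, 1, 1] \<in> Srj_club 3 2" "[0, 1, 1] \<in> Fun_club 3 2"
    unfolding Srj Fun_club_def lessThans by auto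

  \<comment> \<open>The realizable maps depend on the chosen \<open>B\<close> and \<open>I\<close>.
    The premise \<open>le\<close> therefore speaks of every class \<open>R\<close> with the
    \<open>pro\<close> closure properties, and is used with \<open>R\<close> the realizable maps;
    each available combinator puts its elementary map into \<open>R\<close>.\<close>
  have complete: "weakly_combinatory_complete S' M A ap"
    if BI: "has CombB" "has CombI"
      and le: "\<And>R. pro R \<Longrightarrow> (has CombC \<Longrightarrow> [1, 0] \<in> S 2 2 \<Longrightarrow> [0, 2, 1] \<in> S 3 3 \<Longrightarrow> [1, 0] \<in> R 2 2) \<Longrightarrow>
        (has CombK \<Longrightarrow> [] \<in> S 0 1 \<Longrightarrow> [0] \<in> S 1 2 \<Longrightarrow> [] \<in> R 0 1) \<Longrightarrow>
        (has CombW \<Longrightarrow> [0, 0] \<in> S 2 1 \<Longrightarrow> [0, 1, 1] \<in> S 3 2 \<Longrightarrow> [0, 0] \<in> R 2 1) \<Longrightarrow> S' \<le> R"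
    for S'
  proof -
    obtain B I where "B \<in> hom M [] A" "combinator_law M A ap CombB B"
      "I \<in> hom M [] A" "combinator_law M A ap CombI I"
      using BI unfolding has_def by blast
    then interpret BI_algebra S M A ap B I
      by unfold_locales (simp_all add: ops_def)
    show ?thesis
    proof (rule weakly_complete, rule le)
      show "pro realizable" by (rule realizable.pro_axioms)
    qed (use realizable_swap realizable_drop realizable_merge in \<open>auto simp: has_def ops_def\<close>)
  qed
  have sub: "a \<in> S n m" if "S' \<le> S" "a \<in> S' n m" for S' :: map_class and a n m
    using that by (auto simp: le_fun_def)
  \<comment> \<open>The converse direction for all combinators at once: \<open>C\<close>,
    \<open>W\<close> and \<open>K\<close> are obtained if the map in their law belongs to
    \<open>S'\<close>, and \<open>B\<close> and \<open>I\<close> in any case.\<close>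
  have law: "has c"
    if "weakly_combinatory_complete S' M A ap" "S' \<le> S"
      "c = CombC \<Longrightarrow> [0, 2, 1] \<in> S' 3 3" "c = CombW \<Longrightarrow> [0, 1, 1] \<in> S' 3 2" "c = CombK \<Longrightarrow> [0] \<in> S' 1 2"
    for S' c
    unfolding has_def
    using that complete_CombB[OF that(1)] complete_CombI[OF that(1)]
      complete_CombC[OF that(1,2)] complete_CombW[OF that(1,2)] complete_CombK[OF that(1,2)]
    by (cases c) blast+
  show ?thesis
    unfolding alg
  proof (intro conjI impI)
    assume le: "Bij_club \<le> S"
    show "weakly_combinatory_complete Bij_club M A ap \<longleftrightarrow> (\<forall>c\<in>{CombB, CombC, CombI}. has c)"
      using law[OF _ le] swap3 complete[of Bij_club] pro.Bij_club_le sub[OF le swap(1)] sub[OF le swap3(1)]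
      by blast
  next
    assume le: "Minj_club \<le> S"
    show "weakly_combinatory_complete Minj_club M A ap \<longleftrightarrow> (\<forall>c\<in>{CombB, CombK, CombI}. has c)"
      using law[OF _ le] drop2 complete[of Minj_club] pro.Minj_club_le sub[OF le drop(1)] sub[OF le drop2(1)]
      by blast
  next
    assume le: "Inj_club \<le> S"
    show "weakly_combinatory_complete Inj_club M A ap \<longleftrightarrow> (\<forall>c\<in>{CombB, CombC, CombK, CombI}. has c)"
      using law[OF _ le] swap3 drop2 complete[of Inj_club] pro.Inj_club_le
        sub[OF le swap(2)] sub[OF le swap3(2)] sub[OF le drop(2)] sub[OF le drop2(2)]
      by blast
  next
    assume le: "Srj_club \<le> S"
    show "weakly_combinatory_complete Srj_club M A ap \<longleftrightarrow> (\<forall>c\<in>{CombB, CombC, CombW, CombI}. has c)"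
      using law[OF _ le] swap3 merge3 complete[of Srj_club] pro.Srj_club_le
        sub[OF le swap(3)] sub[OF le swap3(3)] sub[OF le merge(1)] sub[OF le merge3(1)]
      by blast
  next
    assume "S = Fun_club"
    then have le: "Fun_club \<le> S" by simp
    show "weakly_combinatory_complete Fun_club M A ap \<longleftrightarrow> (\<forall>c\<in>{CombB, CombC, CombK, CombW, CombI}. has c)"
      using law[OF _ le] swap3 drop2 merge3 complete[of Fun_club] pro.Fun_club_le
        sub[OF le swap(4)] sub[OF le swap3(4)] sub[OF le drop(3)] sub[OF le drop2(3)]
        sub[OF le merge(2)] sub[OF le merge3(2)]
      by blast
  qed
qed

end
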